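(* Let $D_n$ ($n\ge 1$) be the Bethe cacti defined below. Then $M(D_1;x,y)=4x^2y^2$, and for every $n\ge 2$, $$M(D_n;x,y)=2\cdot 3^{n-1}x^2y^2+2(3^{n-1}+1)x^2y^4+2(3^{n-1}-2)x^4y^4 .$$
   Context: For a finite simple graph $G$ and integers $i,j\ge 1$, let $m_{i,j}(G)$ be the number of edges $uv$ of $G$ with $\{d_u(G),d_v(G)\}=\{i,j\}$, where $d_v(G)$ is the degree of $v$. The $M$-polynomial of $G$ is $M(G;x,y)=\sum_{i\le j} m_{i,j}(G)\,x^iy^j$. Bethe cacti $D_n$ are rooted graphs defined recursively: $D_1$ is a $4$-cycle with one designated vertex, its root. For $n\ge 2$, take a $4$-cycle with vertices $a,b,c,d$ in cyclic order, declare $a$ to be the root of $D_n$, and take three disjoint copies of $D_{n-1}$; identify the root of the first copy with $b$, the root of the second copy with $c$, and the root of the third copy with $d$. *)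

theory Defs
  imports Main "HOL-Computational_Algebra.Polynomial"
begin

record 'a graph =
  verts :: "'a set"
  edges :: "'a set set"

definition simple_graph :: "'a graph \<Rightarrow> bool" where
  "simple_graph G \<longleftrightarrow>
     finite (verts G) \<and> (\<forall>e\<in>edges G. e \<subseteq> verts G \<and> card e = 2)"

definition degree_in :: "'a graph \<Rightarrow> 'a \<Rightarrow> nat" where
  "degree_in G v = card {e \<in> edges G. v \<in> e}"

definition m_count :: "'a graph \<Rightarrow> nat \<Rightarrow> nat \<Rightarrow> nat" where
  "m_count G i j =
     card {e \<in> edges G. \<exists>u v. e = {u, v} \<and> {degree_in G u, degree_in G v} = {i, j}}"

text \<open>Polynomials in \<open>x\<close> and \<open>y\<close> over the integers are polynomials in \<open>y\<close> whose coefficients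
  are polynomials in \<open>x\<close>.\<close>

abbreviation var_x :: "int poly poly" where "var_x \<equiv> [:[:0, 1:]:]"
abbreviation var_y :: "int poly poly" where "var_y \<equiv> [:0, 1:]"

text \<open>The sum over all \<open>1 \<le> i \<le> j\<close> is restricted to its nonzero terms, of which a finite graph
  has only finitely many (lemma \<open>finite_M_support\<close> below).\<close>

definition M_polynomial :: "'a graph \<Rightarrow> int poly poly" where
  "M_polynomial G =
     (\<Sum>(i, j) \<in> {(i, j). 1 \<le> i \<and> i \<le> j \<and> m_count G i j \<noteq> 0}.
        of_nat (m_count G i j) * var_x ^ i * var_y ^ j)"

text \<open>\<open>bethe_cactus n G r\<close>: the graph \<open>G\<close> with root \<open>r\<close> is a realization of \<open>D\<^sub>n\<close>.
  The recursion determines \<open>D\<^sub>n\<close> only up to isomorphism of rooted graphs, hence a predicate on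
  graphs with vertices of an arbitrary type. In the recursive step the three copies already have
  the vertices \<open>b\<close>, \<open>c\<close>, \<open>d\<close> of the new 4-cycle as their roots, so the identification of roots
  amounts to taking unions. Realizations exist for every \<open>n \<ge> 1\<close> and are unique up to isomorphism
  (lemmas \<open>bethe_cactus_exists\<close> and \<open>bethe_cactus_unique\<close> below).\<close>

inductive bethe_cactus :: "nat \<Rightarrow> 'a graph \<Rightarrow> 'a \<Rightarrow> bool" where
  base: "distinct [a, b, c, d] \<Longrightarrow>
    bethe_cactus 1 \<lparr>verts = {a, b, c, d}, edges = {{a, b}, {b, c}, {c, d}, {d, a}}\<rparr> a"
| step: "bethe_cactus n G1 b \<Longrightarrow> bethe_cactus n G2 c \<Longrightarrow> bethe_cactus n G3 d \<Longrightarrow>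
    verts G1 \<inter> verts G2 = {} \<Longrightarrow> verts G1 \<inter> verts G3 = {} \<Longrightarrow> verts G2 \<inter> verts G3 = {} \<Longrightarrow>
    a \<notin> verts G1 \<union> verts G2 \<union> verts G3 \<Longrightarrow>
    bethe_cactus (Suc n)
      \<lparr>verts = insert a (verts G1 \<union> verts G2 \<union> verts G3),
       edges = {{a, b}, {b, c}, {c, d}, {d, a}} \<union> edges G1 \<union> edges G2 \<union> edges G3\<rparr> a"

lemma finite_M_support:
  assumes "simple_graph G"
  shows "finite {(i, j). 1 \<le> i \<and> i \<le> j \<and> m_count G i j \<noteq> 0}"
proof (rule finite_subset)
  let ?D = "degree_in G ` verts G"
  show "{(i, j). 1 \<le> i \<and> i \<le> j \<and> m_count G i j \<noteq> 0} \<subseteq> ?D \<times> ?D"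
  proof (intro subsetI, clarsimp)
    fix i j assume "0 < m_count G i j"
    then have "{e \<in> edges G. \<exists>u v. e = {u, v} \<and> {degree_in G u, degree_in G v} = {i, j}} \<noteq> {}"
      unfolding m_count_def by (metis (no_types, lifting) card.empty less_irrefl)
    then obtain u v where "{u, v} \<in> edges G" "{degree_in G u, degree_in G v} = {i, j}" by auto
    moreover from this have "u \<in> verts G" "v \<in> verts G"
      using assms unfolding simple_graph_def by auto
    ultimately show "i \<in> ?D \<and> j \<in> ?D" by (auto simp: doubleton_eq_iff)
  qed
  show "finite (?D \<times> ?D)" using assms unfolding simple_graph_def by auto
qed

lemma root_in_verts: "bethe_cactus n G r \<Longrightarrow> r \<in> verts G"
  by (induction rule: bethe_cactus.induct) auto

lemma bethe_cactus_simple: "bethe_cactus n G r \<Longrightarrow> simple_graph G"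
proof (induction rule: bethe_cactus.induct)
  case (base a b c d)
  then show ?case by (auto simp: simple_graph_def)
next
  case (step n G1 b G2 c G3 d a)
  have "b \<in> verts G1" "c \<in> verts G2" "d \<in> verts G3"
    using step.hyps root_in_verts by auto
  moreover from this have "a \<noteq> b" "b \<noteq> c" "c \<noteq> d" "d \<noteq> a" using step.hyps by auto
  ultimately show ?case using step.IH by (auto simp: simple_graph_def)
qed

lemma bethe_cactus_image:
  assumes "bethe_cactus n G r" "inj f"
  shows "bethe_cactus n \<lparr>verts = f ` verts G, edges = (`) f ` edges G\<rparr> (f r)"
  using assms(1)
proof (induction rule: bethe_cactus.induct)
  case (base a b c d)
  then have "distinct [f a, f b, f c, f d]" using assms(2) by (auto dest: injD)
  from bethe_cactus.base[OF this] show ?case by simp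
next
  case (step n G1 b G2 c G3 d a)
  have disj: "f ` A \<inter> f ` B = {}" if "A \<inter> B = {}" for A B
    using that assms(2) by (auto dest: injD)
  have "f a \<notin> f ` verts G1 \<union> f ` verts G2 \<union> f ` verts G3"
    using step.hyps assms(2) by (auto dest: injD)
  then have "bethe_cactus (Suc n)
      \<lparr>verts = insert (f a) (f ` verts G1 \<union> f ` verts G2 \<union> f ` verts G3),
       edges = {{f a, f b}, {f b, f c}, {f c, f d}, {f d, f a}} \<union> (`) f ` edges G1
         \<union> (`) f ` edges G2 \<union> (`) f ` edges G3\<rparr> (f a)"
    using bethe_cactus.step[OF step.IH, of "f a"] disj step.hyps(4-6) by simp
  then show ?case by (simp add: image_Un)
qed

lemma bethe_cactus_exists:
  assumes "n \<ge> 1"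
  shows "\<exists>(G :: nat list graph) r. bethe_cactus n G r"
  using assms
proof (induction n rule: dec_induct)
  case base
  have "distinct [[0::nat], [1], [2], [3]]" by simp
  from bethe_cactus.base[OF this] show ?case by blast
next
  case (step n)
  then obtain G :: "nat list graph" and r where "bethe_cactus n G r" by blast
  then have *: "bethe_cactus n \<lparr>verts = (#) k ` verts G, edges = (`) ((#) k) ` edges G\<rparr> (k # r)"
    for k :: nat by (rule bethe_cactus_image) (simp add: inj_def)
  show ?case
    by (rule exI, rule exI, rule bethe_cactus.step[OF *[of 0] *[of 1] *[of 2], of "[]"]) auto
qed

lemma bethe_cactus_unique:
  assumes "bethe_cactus n G r" "bethe_cactus n G' r'"
  shows "\<exists>f. bij_betw f (verts G) (verts G') \<and> edges G' = (`) f ` edges G \<and> f r = r'"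
  using assms
proof (induction arbitrary: G' r' rule: bethe_cactus.induct)
  case (base a b c d)
  have no0: "\<not> bethe_cactus 0 H s" for H :: "'b graph" and s
    by (auto elim: bethe_cactus.cases)
  from base.prems obtain b' c' d' where d': "distinct [r', b', c', d']"
    and G': "G' = \<lparr>verts = {r', b', c', d'}, edges = {{r', b'}, {b', c'}, {c', d'}, {d', r'}}\<rparr>"
  proof (cases rule: bethe_cactus.cases)
    case step
    then show ?thesis using no0 by simp
  qed (use that in blast)
  define f where "f = (\<lambda>_. r')(b := b', c := c', d := d')"
  have "f a = r'" "f b = b'" "f c = c'" "f d = d'" using base by (auto simp: f_def)
  then show ?case unfolding G' using base d' by (intro exI[of _ f]) (simp add: bij_betw_def)
next
  case (step n G1 b G2 c G3 d a)
  have n: "n \<noteq> 0" using step.hyps(1) by (auto elim: bethe_cactus.cases)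
  from step.prems obtain H1 H2 H3 b' c' d' where
    H: "bethe_cactus n H1 b'" "bethe_cactus n H2 c'" "bethe_cactus n H3 d'"
    and disj: "verts H1 \<inter> verts H2 = {}" "verts H1 \<inter> verts H3 = {}" "verts H2 \<inter> verts H3 = {}"
      "r' \<notin> verts H1 \<union> verts H2 \<union> verts H3"
    and G': "G' = \<lparr>verts = insert r' (verts H1 \<union> verts H2 \<union> verts H3),
       edges = {{r', b'}, {b', c'}, {c', d'}, {d', r'}} \<union> edges H1 \<union> edges H2 \<union> edges H3\<rparr>"
  proof (cases rule: bethe_cactus.cases)
    case base
    then show ?thesis using n by simp
  next
    case (step H1 b' H2 c' H3 d')
    then show ?thesis using that[of H1 b' H2 c' H3 d'] by simp
  qed
  obtain f1 where f1: "bij_betw f1 (verts G1) (verts H1)" "edges H1 = (`) f1 ` edges G1" "f1 b = b'"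
    using step.IH(1)[OF H(1)] by blast
  obtain f2 where f2: "bij_betw f2 (verts G2) (verts H2)" "edges H2 = (`) f2 ` edges G2" "f2 c = c'"
    using step.IH(2)[OF H(2)] by blast
  obtain f3 where f3: "bij_betw f3 (verts G3) (verts H3)" "edges H3 = (`) f3 ` edges G3" "f3 d = d'"
    using step.IH(3)[OF H(3)] by blast
  define f where "f v = (if v \<in> verts G1 then f1 v else if v \<in> verts G2 then f2 v
    else if v \<in> verts G3 then f3 v else r')" for v
  have e1: "f v = f1 v" if "v \<in> verts G1" for v using that by (simp add: f_def)
  have e2: "f v = f2 v" if "v \<in> verts G2" for v using that step.hyps by (auto simp: f_def)
  have e3: "f v = f3 v" if "v \<in> verts G3" for v using that step.hyps by (auto simp: f_def)
  have e4: "f a = r'" using step.hyps by (simp add: f_def)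
  have sub: "\<And>e. e \<in> edges G1 \<Longrightarrow> e \<subseteq> verts G1" "\<And>e. e \<in> edges G2 \<Longrightarrow> e \<subseteq> verts G2"
    "\<And>e. e \<in> edges G3 \<Longrightarrow> e \<subseteq> verts G3"
    using step.hyps(1-3)[THEN bethe_cactus_simple] by (auto simp: simple_graph_def)
  have img: "(`) f ` X = (`) g ` X"
    if "\<And>e. e \<in> X \<Longrightarrow> e \<subseteq> V" "\<And>v. v \<in> V \<Longrightarrow> f v = g v" for X V g
  proof (rule image_cong[OF refl])
    fix e assume "e \<in> X"
    then show "f ` e = g ` e" using that by (intro image_cong[OF refl]) blast
  qed
  have E: "(`) f ` edges G1 = edges H1" "(`) f ` edges G2 = edges H2" "(`) f ` edges G3 = edges H3"
    using img[OF sub(1) e1] img[OF sub(2) e2] img[OF sub(3) e3] f1(2) f2(2) f3(2) by simp_all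
  have R: "f b = b'" "f c = c'" "f d = d'"
    using e1 e2 e3 f1(3) f2(3) f3(3) step.hyps(1-3)[THEN root_in_verts] by auto
  have B1: "bij_betw f (verts G1) (verts H1)"
    using f1(1) e1 bij_betw_cong[of "verts G1" f f1] by simp
  have B2: "bij_betw f (verts G2) (verts H2)"
    using f2(1) e2 bij_betw_cong[of "verts G2" f f2] by simp
  have B3: "bij_betw f (verts G3) (verts H3)"
    using f3(1) e3 bij_betw_cong[of "verts G3" f f3] by simp
  have B4: "bij_betw f {a} {r'}" using e4 by (simp add: bij_betw_def)
  have "bij_betw f ({a} \<union> (verts G1 \<union> verts G2 \<union> verts G3))
      ({r'} \<union> (verts H1 \<union> verts H2 \<union> verts H3))"
    by (intro bij_betw_combine B1 B2 B3 B4) (use disj in auto)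
  then show ?case unfolding G' using E R e4 by (intro exI[of _ f]) (simp add: image_Un)
qed

end

theory Submission
  imports Defs
begin

text \<open>The \<open>M\<close>-polynomial is the sum over all edges of a weight depending only on the set of degrees
  of the two ends. When a copy of \<open>D\<^sub>n\<close> is attached to the new 4-cycle, only the degree of its root
  changes, from \<open>2\<close> to \<open>4\<close>. So for an arbitrary weight one computes the sum over the edges of \<open>D\<^sub>n\<close>
  with the degree of the root replaced by \<open>4\<close>, which satisfies a linear recurrence in \<open>n\<close>, and
  reads off the sum with the true degrees from one further step of the recursion.\<close>

section \<open>The \<open>M\<close>-polynomial as a sum over edges\<close>

lemma simple_graph_finite_edges:
  assumes "simple_graph G"
  shows "finite (edges G)"
proof (rule finite_subset)
  show "edges G \<subseteq> Pow (verts G)" using assms by (auto simp: simple_graph_def)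
  show "finite (Pow (verts G))" using assms by (simp add: simple_graph_def)
qed

text \<open>Turns a degree into an edge sum, so that \<open>sum_edges_glue\<close> also yields the
  degrees of a glued graph.\<close>

lemma degree_in_eq_sum:
  assumes "finite (edges G)"
  shows "degree_in G v = (\<Sum>e\<in>edges G. of_bool (v \<in> e))"
  using assms by (simp add: degree_in_def Int_def)

text \<open>Group the edges by the sorted pair of their end degrees: \<open>m_count G i j\<close> is
  the size of the fibre over \<open>(i, j)\<close>. Every edge is counted, since its ends have
  degree at least 1. The exponents \<open>Min\<close> and \<open>Max\<close> depend only on the set
  of degrees.\<close>

lemma M_polynomial_eq_sum_edges:
  assumes "simple_graph G"
  shows "M_polynomial G =
    (\<Sum>e\<in>edges G. var_x ^ Min (degree_in G ` e) * var_y ^ Max (degree_in G ` e))"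
proof -
  define t where "t e = (Min (degree_in G ` e), Max (degree_in G ` e))" for e
  have fin: "finite (edges G)" using assms by (rule simple_graph_finite_edges)
  have deg_pos: "1 \<le> degree_in G v" if "e \<in> edges G" "v \<in> e" for e v
    using that fin by (auto simp: degree_in_def Suc_le_eq card_gt_0_iff)
  \<comment> \<open>For \<open>i\<close> \<le> \<open>j\<close>, the unordered pair of degrees
    carries the same information as the ordered pair (minimum, maximum).\<close>
  have t_iff: "(\<exists>u v. e = {u, v} \<and> {degree_in G u, degree_in G v} = {i, j}) \<longleftrightarrow> t e = (i, j)"
    if "e \<in> edges G" "i \<le> j" for e i j
  proof -
    have "card e = 2" using that assms by (simp add: simple_graph_def)
    then obtain u v where e: "e = {u, v}" by (auto simp: card_2_iff)
    show ?thesis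
      using \<open>i \<le> j\<close> by (auto simp: e t_def doubleton_eq_iff min_def max_def)
  qed
  have m: "m_count G i j = card {e \<in> edges G. t e = (i, j)}" if "i \<le> j" for i j
    unfolding m_count_def using t_iff that by (metis (no_types, lifting))
  have t_ge: "1 \<le> fst (t e) \<and> fst (t e) \<le> snd (t e)" if "e \<in> edges G" for e
  proof -
    have "card e = 2" using that assms by (simp add: simple_graph_def)
    then obtain u v where e: "e = {u, v}" by (auto simp: card_2_iff)
    show ?thesis using deg_pos[OF that] by (auto simp: e t_def min_def max_def)
  qed
  have supp: "{(i, j). 1 \<le> i \<and> i \<le> j \<and> m_count G i j \<noteq> 0} = t ` edges G" (is "?S = _")
  proof (intro equalityI subsetI)
    fix p assume "p \<in> ?S"
    then obtain i j where p: "p = (i, j)" "i \<le> j" "m_count G i j \<noteq> 0" by blast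
    then have "{e \<in> edges G. t e = (i, j)} \<noteq> {}" by (metis m card.empty)
    then show "p \<in> t ` edges G" using p(1) by (auto intro: rev_image_eqI)
  next
    fix p assume "p \<in> t ` edges G"
    then obtain e where e: "e \<in> edges G" "p = t e" by blast
    obtain i j where ij: "t e = (i, j)" by fastforce
    then have "1 \<le> i" "i \<le> j" using t_ge[OF e(1)] by auto
    moreover have "0 < card {e \<in> edges G. t e = (i, j)}"
      unfolding card_gt_0_iff using e ij fin by auto
    ultimately show "p \<in> ?S" using e ij by (auto simp: m)
  qed
  have "M_polynomial G =
      (\<Sum>p\<in>t ` edges G. \<Sum>e\<in>{e \<in> edges G. t e = p}. var_x ^ fst (t e) * var_y ^ snd (t e))"
    unfolding M_polynomial_def supp
  proof (rule sum.cong[OF refl], clarify)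
    fix i j e assume e: "(i, j) = t e" "e \<in> edges G"
    then have "i \<le> j" using t_ge[OF e(2)] by (simp flip: e(1))
    then show "of_nat (m_count G i j) * var_x ^ i * var_y ^ j =
        (\<Sum>e'\<in>{e' \<in> edges G. t e' = (i, j)}. var_x ^ fst (t e') * var_y ^ snd (t e'))"
      by (simp add: m mult.assoc)
  qed
  also have "\<dots> = (\<Sum>e\<in>edges G. var_x ^ fst (t e) * var_y ^ snd (t e))"
    by (rule sum.image_gen[OF fin, symmetric])
  finally show ?thesis by (simp add: t_def)
qed

section \<open>Attaching three disjoint graphs to a 4-cycle\<close>

definition cycle4_glue ::
    "'a \<Rightarrow> 'a \<Rightarrow> 'a \<Rightarrow> 'a \<Rightarrow> 'a graph \<Rightarrow> 'a graph \<Rightarrow> 'a graph \<Rightarrow> 'a graph" where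
  "cycle4_glue a b c d G1 G2 G3 =
     \<lparr>verts = insert a (verts G1 \<union> verts G2 \<union> verts G3),
      edges = {{a, b}, {b, c}, {c, d}, {d, a}} \<union> edges G1 \<union> edges G2 \<union> edges G3\<rparr>"

lemma sum_cycle4:
  fixes w :: "'a set \<Rightarrow> 'b :: comm_monoid_add"
  assumes "distinct [a, b, c, d]"
  shows "sum w {{a, b}, {b, c}, {c, d}, {d, a}} = w {a, b} + w {b, c} + w {c, d} + w {d, a}"
  using assms by (auto simp: doubleton_eq_iff add.assoc)

context
  fixes G1 G2 G3 :: "'a graph" and a b c d :: 'a
  assumes simple: "simple_graph G1" "simple_graph G2" "simple_graph G3"
    and roots: "b \<in> verts G1" "c \<in> verts G2" "d \<in> verts G3"
    and disj: "verts G1 \<inter> verts G2 = {}" "verts G1 \<inter> verts G3 = {}" "verts G2 \<inter> verts G3 = {}"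
    and fresh: "a \<notin> verts G1 \<union> verts G2 \<union> verts G3"
begin

lemma glue_distinct: "distinct [a, b, c, d]"
  using roots disj fresh by auto

text \<open>The four edge sets involved are pairwise disjoint and the cycle has four distinct edges,
  so nothing is counted twice.\<close>

lemma sum_edges_glue:
  fixes w :: "'a set \<Rightarrow> 'b :: comm_monoid_add"
  shows "sum w (edges (cycle4_glue a b c d G1 G2 G3)) =
    w {a, b} + w {b, c} + w {c, d} + w {d, a}
    + sum w (edges G1) + sum w (edges G2) + sum w (edges G3)"
proof -
  let ?C = "{{a, b}, {b, c}, {c, d}, {d, a}}"
  \<comment> \<open>Nonemptiness matters: disjoint vertex sets alone would still allow the empty set
    as a common edge.\<close>
  have sub: "e \<subseteq> verts G \<and> e \<noteq> {}" if "e \<in> edges G" "simple_graph G" for e and G :: "'a graph"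
    using that by (auto simp: simple_graph_def)
  \<comment> \<open>A cycle edge either contains the fresh vertex \<open>a\<close> or joins two
    different copies, so it lies inside no copy.\<close>
  have C: "\<not> e \<subseteq> verts G1" "\<not> e \<subseteq> verts G2" "\<not> e \<subseteq> verts G3" if "e \<in> ?C" for e
    using that roots disj fresh by auto
  have disj_edges: "edges G \<inter> edges H = {}"
    if "simple_graph G" "simple_graph H" "verts G \<inter> verts H = {}" for G H :: "'a graph"
    using sub[OF _ that(1)] sub[OF _ that(2)] that(3) by fast
  have C_disj: "?C \<inter> edges G1 = {}" "?C \<inter> edges G2 = {}" "?C \<inter> edges G3 = {}"
    using C sub[OF _ simple(1)] sub[OF _ simple(2)] sub[OF _ simple(3)] by (meson disjoint_iff)+
  have fin: "finite ?C" "finite (edges G1)" "finite (edges G2)" "finite (edges G3)"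
    using simple[THEN simple_graph_finite_edges] by simp_all
  \<comment> \<open>Stated for a variable \<open>X\<close>, so that simplification does not take the
    explicit set \<open>?C\<close> apart.\<close>
  have sum_Un: "sum w (X \<union> edges G1 \<union> edges G2 \<union> edges G3) =
      sum w X + sum w (edges G1) + sum w (edges G2) + sum w (edges G3)"
    if "finite X" "X \<inter> edges G1 = {}" "X \<inter> edges G2 = {}" "X \<inter> edges G3 = {}" for X
    using that fin disj_edges simple disj by (simp add: sum.union_disjoint Int_Un_distrib2)
  have "sum w (?C \<union> edges G1 \<union> edges G2 \<union> edges G3) =
      sum w ?C + sum w (edges G1) + sum w (edges G2) + sum w (edges G3)"
    by (rule sum_Un[OF fin(1) C_disj])
  then show ?thesis by (simp only: cycle4_glue_def graph.simps sum_cycle4[OF glue_distinct])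
qed

text \<open>Instance of \<open>sum_edges_glue\<close> with the indicator of \<open>v\<close> lying
  in \<open>e\<close> as weight; each cycle vertex lies on exactly two cycle edges.\<close>

lemma degree_in_glue:
  "degree_in (cycle4_glue a b c d G1 G2 G3) v =
     2 * of_bool (v \<in> {a, b, c, d}) + degree_in G1 v + degree_in G2 v + degree_in G3 v"
proof -
  have fin: "finite (edges (cycle4_glue a b c d G1 G2 G3))"
    using simple[THEN simple_graph_finite_edges] by (simp add: cycle4_glue_def)
  show ?thesis
    unfolding degree_in_eq_sum[OF fin] sum_edges_glue
      simple[THEN simple_graph_finite_edges, THEN degree_in_eq_sum]
    using glue_distinct by auto
qed

end

section \<open>Degrees in cacti, and edge sums with a prescribed root degree\<close>

lemma degree_in_outside:
  assumes "simple_graph G" "v \<notin> verts G"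
  shows "degree_in G v = 0"
proof -
  have "{e \<in> edges G. v \<in> e} = {}" using assms by (auto simp: simple_graph_def)
  then show ?thesis unfolding degree_in_def by (simp only: card.empty)
qed

lemma degree_in_cycle4:
  assumes "distinct [a, b, c, d]"
  shows "degree_in \<lparr>verts = V, edges = {{a, b}, {b, c}, {c, d}, {d, a}}\<rparr> v =
    2 * of_bool (v \<in> {a, b, c, d})"
proof -
  have "degree_in \<lparr>verts = V, edges = {{a, b}, {b, c}, {c, d}, {d, a}}\<rparr> v =
      (\<Sum>e\<in>{{a, b}, {b, c}, {c, d}, {d, a}}. of_bool (v \<in> e))"
    by (subst degree_in_eq_sum) simp_all
  then show ?thesis using assms unfolding sum_cycle4[OF assms] by auto
qed

text \<open>The root is outside all three copies, so only its two cycle edges contribute.\<close>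

lemma bethe_cactus_root_degree:
  "bethe_cactus n G r \<Longrightarrow> degree_in G r = 2"
proof (induction rule: bethe_cactus.induct)
  case (base a b c d)
  then show ?case by (simp add: degree_in_cycle4)
next
  case (step n G1 b G2 c G3 d a)
  note simple = step.hyps(1-3)[THEN bethe_cactus_simple]
  note roots = step.hyps(1-3)[THEN root_in_verts]
  show ?case
    using degree_in_glue[OF simple roots step.hyps(4-7), of a] step.hyps(7) simple
    by (simp add: degree_in_outside cycle4_glue_def)
qed

text \<open>The parameter \<open>k\<close> serves two purposes: \<open>k = 4\<close> gives the
  recurrence for a cactus that is itself to be attached, \<open>k = 2\<close> gives the sum with the
  true degrees. The edges at \<open>a\<close> contribute \<open>w {k, 4}\<close>, the other two
  cycle edges \<open>w {4}\<close>.\<close>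

lemma sum_edges_bethe_cactus_glue:
  fixes w :: "nat set \<Rightarrow> 'b :: comm_semiring_1"
  assumes cacti: "bethe_cactus n G1 b" "bethe_cactus n G2 c" "bethe_cactus n G3 d"
    and disj: "verts G1 \<inter> verts G2 = {}" "verts G1 \<inter> verts G3 = {}" "verts G2 \<inter> verts G3 = {}"
    and fresh: "a \<notin> verts G1 \<union> verts G2 \<union> verts G3"
  defines "G \<equiv> cycle4_glue a b c d G1 G2 G3"
  shows "(\<Sum>e\<in>edges G. w ((degree_in G)(a := k) ` e)) =
    2 * w {k, 4} + 2 * w {4}
    + (\<Sum>e\<in>edges G1. w ((degree_in G1)(b := 4) ` e))
    + (\<Sum>e\<in>edges G2. w ((degree_in G2)(c := 4) ` e))
    + (\<Sum>e\<in>edges G3. w ((degree_in G3)(d := 4) ` e))"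
proof -
  note simple = cacti[THEN bethe_cactus_simple]
  note roots = cacti[THEN root_in_verts]
  note deg = degree_in_glue[OF simple roots disj fresh, folded G_def]
  note out = simple[THEN degree_in_outside]
  have root_deg: "degree_in G1 b = 2" "degree_in G2 c = 2" "degree_in G3 d = 2"
    using cacti by (auto dest: bethe_cactus_root_degree)
  have distinct: "distinct [a, b, c, d]" using roots disj fresh by auto
  \<comment> \<open>On the vertices of one copy the degrees in the other copies vanish, and the
    cycle affects only the root of that copy, raising its degree to 2 + 2 = 4.\<close>
  have D1: "((degree_in G)(a := k)) v = ((degree_in G1)(b := 4)) v" if "v \<in> verts G1" for v
  proof -
    have "v \<notin> verts G2" "v \<notin> verts G3" "v \<noteq> a" "v \<noteq> c" "v \<noteq> d"
      using that roots disj fresh by auto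
    then show ?thesis by (simp add: deg out root_deg)
  qed
  have D2: "((degree_in G)(a := k)) v = ((degree_in G2)(c := 4)) v" if "v \<in> verts G2" for v
  proof -
    have "v \<notin> verts G1" "v \<notin> verts G3" "v \<noteq> a" "v \<noteq> b" "v \<noteq> d"
      using that roots disj fresh by auto
    then show ?thesis by (simp add: deg out root_deg)
  qed
  have D3: "((degree_in G)(a := k)) v = ((degree_in G3)(d := 4)) v" if "v \<in> verts G3" for v
  proof -
    have "v \<notin> verts G1" "v \<notin> verts G2" "v \<noteq> a" "v \<noteq> b" "v \<noteq> c"
      using that roots disj fresh by auto
    then show ?thesis by (simp add: deg out root_deg)
  qed
  have sum_eq: "(\<Sum>e\<in>edges H. w (f ` e)) = (\<Sum>e\<in>edges H. w (g ` e))"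
    if "simple_graph H" "\<And>v. v \<in> verts H \<Longrightarrow> f v = g v" for H :: "'a graph" and f g
  proof (rule sum.cong[OF refl])
    fix e assume "e \<in> edges H"
    then have "e \<subseteq> verts H" using that(1) by (auto simp: simple_graph_def)
    then have "f ` e = g ` e" using that(2) by (intro image_cong[OF refl]) blast
    then show "w (f ` e) = w (g ` e)" by simp
  qed
  have D4: "((degree_in G)(a := k)) b = 4" "((degree_in G)(a := k)) c = 4"
    "((degree_in G)(a := k)) d = 4" "((degree_in G)(a := k)) a = k"
    using D1 D2 D3 roots by auto
  have sums:
    "(\<Sum>e\<in>edges G1. w ((degree_in G)(a := k) ` e)) = (\<Sum>e\<in>edges G1. w ((degree_in G1)(b := 4) ` e))"
    "(\<Sum>e\<in>edges G2. w ((degree_in G)(a := k) ` e)) = (\<Sum>e\<in>edges G2. w ((degree_in G2)(c := 4) ` e))"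
    "(\<Sum>e\<in>edges G3. w ((degree_in G)(a := k) ` e)) = (\<Sum>e\<in>edges G3. w ((degree_in G3)(d := 4) ` e))"
    by (rule sum_eq[OF simple(1)], erule D1, rule sum_eq[OF simple(2)], erule D2,
        rule sum_eq[OF simple(3)], erule D3)
  show ?thesis
    unfolding sum_edges_glue[OF simple roots disj fresh, folded G_def] sums
    by (simp only: image_insert image_empty D4)
      (simp add: insert_commute mult_2 add_ac)
qed

lemma sum_edges_cycle4:
  fixes w :: "nat set \<Rightarrow> 'b :: comm_semiring_1"
  assumes "distinct [a, b, c, d]"
  defines "G \<equiv> \<lparr>verts = {a, b, c, d}, edges = {{a, b}, {b, c}, {c, d}, {d, a}}\<rparr>"
  shows "(\<Sum>e\<in>edges G. w ((degree_in G)(a := k) ` e)) = 2 * w {2, k} + 2 * w {2}"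
proof -
  have D: "((degree_in G)(a := k)) b = 2" "((degree_in G)(a := k)) c = 2"
    "((degree_in G)(a := k)) d = 2" "((degree_in G)(a := k)) a = k"
    using assms(1) by (auto simp: G_def degree_in_cycle4)
  have E: "edges G = {{a, b}, {b, c}, {c, d}, {d, a}}" by (simp add: G_def)
  show ?thesis
    unfolding E sum_cycle4[OF assms(1)]
    by (simp only: image_insert image_empty D) (simp add: insert_commute mult_2 add_ac)
qed

text \<open>Writing \<open>S n\<close> for the left-hand side, gluing with \<open>k = 4\<close>
  gives \<open>S (n + 1) = 3 * S n + 4 * w {4}\<close>, starting from
  \<open>S 1 = 2 * w {2} + 2 * w {2, 4}\<close>; the right-hand side solves this recurrence.\<close>

lemma sum_edges_bethe_cactus_root4:
  fixes w :: "nat set \<Rightarrow> 'b :: comm_ring_1"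
  assumes "bethe_cactus n G r"
  shows "(\<Sum>e\<in>edges G. w ((degree_in G)(r := 4) ` e)) =
    2 * 3 ^ (n - 1) * (w {2} + w {2, 4}) + 2 * (3 ^ (n - 1) - 1) * w {4}"
  using assms
proof (induction rule: bethe_cactus.induct)
  case (base a b c d)
  show ?case unfolding sum_edges_cycle4[OF base] by (simp add: algebra_simps)
next
  case (step n G1 b G2 c G3 d a)
  \<comment> \<open>Excluding \<open>n = 0\<close> makes the truncated \<open>n - 1\<close> a true
    predecessor.\<close>
  have "n \<noteq> 0" using step.hyps(1) by (auto elim: bethe_cactus.cases)
  then obtain m where n: "n = Suc m" by (cases n) auto
  show ?case
    unfolding sum_edges_bethe_cactus_glue[OF step.hyps, unfolded cycle4_glue_def] step.IH
    by (simp add: n algebra_simps)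
qed

theorem theorem3p1:
  fixes n :: nat and G :: "'a graph" and r :: 'a
  assumes "bethe_cactus n G r"
  shows "(n = 1 \<longrightarrow> M_polynomial G = 4 * var_x ^ 2 * var_y ^ 2) \<and>
         (n \<ge> 2 \<longrightarrow> M_polynomial G =
             2 * 3 ^ (n - 1) * var_x ^ 2 * var_y ^ 2
           + 2 * (3 ^ (n - 1) + 1) * var_x ^ 2 * var_y ^ 4
           + 2 * (3 ^ (n - 1) - 2) * var_x ^ 4 * var_y ^ 4)"
proof -
  \<comment> \<open>With opaque names for the variables, the final equations become plain ring
    identities.\<close>
  define x y where "x = var_x" and "y = var_y"
  define w where "w S = x ^ Min S * y ^ Max S" for S :: "nat set"
  have w: "w {2} = x ^ 2 * y ^ 2" "w {2, 4} = x ^ 2 * y ^ 4" "w {4} = x ^ 4 * y ^ 4"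
    by (simp_all add: w_def)
  \<comment> \<open>Overriding the root degree by its true value changes nothing, which brings the
    sum into the form of the lemmas with \<open>k = 2\<close>.\<close>
  have "(degree_in G)(r := 2) = degree_in G"
    using bethe_cactus_root_degree[OF assms] by (simp add: fun_upd_idem)
  then have M: "M_polynomial G = (\<Sum>e\<in>edges G. w ((degree_in G)(r := 2) ` e))"
    by (simp add: M_polynomial_eq_sum_edges[OF bethe_cactus_simple[OF assms]] w_def x_def y_def)
  show ?thesis
    unfolding M x_def[symmetric] y_def[symmetric]
    using assms
  proof cases
    case (base b c d)
    \<comment> \<open>With \<open>k = 2\<close> all four edges have weight
      \<open>w {2}\<close>.\<close>
    show "(n = 1 \<longrightarrow> (\<Sum>e\<in>edges G. w ((degree_in G)(r := 2) ` e)) = 4 * x ^ 2 * y ^ 2) \<and>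
      (n \<ge> 2 \<longrightarrow> (\<Sum>e\<in>edges G. w ((degree_in G)(r := 2) ` e)) =
        2 * 3 ^ (n - 1) * x ^ 2 * y ^ 2 + 2 * (3 ^ (n - 1) + 1) * x ^ 2 * y ^ 4
        + 2 * (3 ^ (n - 1) - 2) * x ^ 4 * y ^ 4)"
      unfolding base(2) sum_edges_cycle4[OF base(3)] by (simp add: base(1) w)
  next
    case (step m G1 b G2 c G3 d)
    have "m \<noteq> 0" using step(3) by (auto elim: bethe_cactus.cases)
    then obtain l where m: "m = Suc l" by (cases m) auto
    \<comment> \<open>Here \<open>n - 1 = m\<close>. The new cycle adds
      \<open>2 * w {2, 4} + 2 * w {4}\<close> to three copies of the sum with root degree 4, so the
      coefficient of \<open>w {4}\<close> is
      \<open>3 * 2 * (3 ^ (m - 1) - 1) + 2 = 2 * (3 ^ m - 2)\<close>.\<close>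
    show "(n = 1 \<longrightarrow> (\<Sum>e\<in>edges G. w ((degree_in G)(r := 2) ` e)) = 4 * x ^ 2 * y ^ 2) \<and>
      (n \<ge> 2 \<longrightarrow> (\<Sum>e\<in>edges G. w ((degree_in G)(r := 2) ` e)) =
        2 * 3 ^ (n - 1) * x ^ 2 * y ^ 2 + 2 * (3 ^ (n - 1) + 1) * x ^ 2 * y ^ 4
        + 2 * (3 ^ (n - 1) - 2) * x ^ 4 * y ^ 4)"
      unfolding step(2) sum_edges_bethe_cactus_glue[OF step(3-9), unfolded cycle4_glue_def]
        step(3-5)[THEN sum_edges_bethe_cactus_root4]
      by (simp add: step(1) m w algebra_simps)
  qed
qed

end
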